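(* Let $\|\mathcal{A}_{2m}\|_\infty$ denote the operator norm of $\mathcal{A}_{2m}$ as an operator from $C(B^2)$ to $C(B^2)$ with the uniform norm. Then $\|\mathcal{A}_{2m}\|_\infty \approx m\log(m+1)$; that is, there exist constants $c_1,c_2>0$, independent of $m$, such that $$c_1\, m\log(m+1) \le \|\mathcal{A}_{2m}\|_\infty \le c_2\, m\log(m+1)$$ for all integers $m\ge 0$.
   Context: $B^2=\{(x,y)\in\mathbb{R}^2: x^2+y^2\le 1\}$. The Radon projection of $f$ is $$\mathcal{R}_\theta(f;t)=\int_{-\sqrt{1-t^2}}^{\sqrt{1-t^2}} f(t\cos\theta - s\sin\theta,\ t\sin\theta+s\cos\theta)\,ds,\quad -1\le t\le1.$$ $U_k$ is the Chebyshev polynomial of the second kind, $U_k(\cos\theta)=\sin((k+1)\theta)/\sin\theta$, and $U_k(\theta;x,y):=U_k(x\cos\theta+y\sin\theta)$. For an integer $m\ge 0$ let $\phi_\nu=\frac{2\pi\nu}{2m+1}$ ($0\le\nu\le 2m$) and $\theta_{j,2m}=\frac{j\pi}{2m+1}$ ($1\le j\le 2m$). The operator $\mathcal{A}_{2m}$ is defined by $$\mathcal{A}_{2m}(f;x,y)=\sum_{\nu=0}^{2m}\sum_{j=1}^{2m}\mathcal{R}_{\phi_\nu}(f;\cos\theta_{j,2m})\,T_{j,\nu}(x,y),$$ $$T_{j,\nu}(x,y)=\frac{1}{(2m+1)^2}\sum_{k=0}^{2m}(k+1)\sin((k+1)\theta_{j,2m})\,U_k(\phi_\nu;x,y).$$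 *)

theory Defs
  imports "HOL-Analysis.Analysis" "HOL-Computational_Algebra.Polynomial"
begin

definition B2 :: "(real \<times> real) set" where
  "B2 = {(x, y). x\<^sup>2 + y\<^sup>2 \<le> 1}"

definition radon :: "real \<Rightarrow> (real \<times> real \<Rightarrow> real) \<Rightarrow> real \<Rightarrow> real" where
  "radon \<theta> f t = integral {- sqrt (1 - t\<^sup>2) .. sqrt (1 - t\<^sup>2)}
     (\<lambda>s. f (t * cos \<theta> - s * sin \<theta>, t * sin \<theta> + s * cos \<theta>))"

fun cheb_U :: "nat \<Rightarrow> real poly" where
  "cheb_U 0 = 1"
| "cheb_U (Suc 0) = [:0, 2:]"
| "cheb_U (Suc (Suc k)) = [:0, 2:] * cheb_U (Suc k) - cheb_U k"

text \<open>The recursion agrees with the trigonometric definition of the second-kind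
  Chebyshev polynomials, and that property determines the polynomial.\<close>

lemma cheb_U_cos_mult: "poly (cheb_U k) (cos \<theta>) * sin \<theta> = sin (real (k + 1) * \<theta>)"
proof (induction k rule: cheb_U.induct)
  case (3 k)
  define a where "a = real (k + 2) * \<theta>"
  have "poly (cheb_U (Suc (Suc k))) (cos \<theta>) * sin \<theta>
      = 2 * cos \<theta> * (poly (cheb_U (Suc k)) (cos \<theta>) * sin \<theta>) - poly (cheb_U k) (cos \<theta>) * sin \<theta>"
    by (simp add: algebra_simps)
  also have "\<dots> = 2 * cos \<theta> * sin (real (Suc k + 1) * \<theta>) - sin (real (k + 1) * \<theta>)"
    using 3 by metis
  also have "real (Suc k + 1) * \<theta> = a"
    by (simp add: a_def algebra_simps)
  also have "real (k + 1) * \<theta> = a - \<theta>"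
    by (simp add: a_def algebra_simps)
  also have "2 * cos \<theta> * sin a - sin (a - \<theta>) = sin (a + \<theta>)"
    by (simp add: sin_add sin_diff)
  also have "a + \<theta> = real (Suc (Suc k) + 1) * \<theta>"
    by (simp add: a_def algebra_simps)
  finally show ?case .
qed (simp_all add: sin_double)

lemma cheb_U_cos:
  "sin \<theta> \<noteq> 0 \<Longrightarrow> poly (cheb_U k) (cos \<theta>) = sin (real (k + 1) * \<theta>) / sin \<theta>"
  using cheb_U_cos_mult[of k \<theta>] by (simp add: field_simps)

lemma cheb_U_unique:
  assumes "\<And>\<theta>. sin \<theta> \<noteq> 0 \<Longrightarrow> poly p (cos \<theta>) = sin (real (k + 1) * \<theta>) / sin \<theta>"
  shows "p = cheb_U k"
proof (rule ccontr)
  assume "p \<noteq> cheb_U k"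
  then have "finite {x. poly (p - cheb_U k) x = 0}"
    by (intro poly_roots_finite) simp
  moreover have "{-1<..<1} \<subseteq> {x. poly (p - cheb_U k) x = 0}"
  proof
    fix x :: real assume x: "x \<in> {-1<..<1}"
    then have "sin (arccos x) \<noteq> 0" using sin_arccos_nonzero[of x] by auto
    then have "poly p (cos (arccos x)) = poly (cheb_U k) (cos (arccos x))"
      using assms cheb_U_cos by metis
    with x show "x \<in> {x. poly (p - cheb_U k) x = 0}" by simp
  qed
  ultimately have "finite {-1<..<(1::real)}" by (rule rev_finite_subset)
  then show False by (simp add: infinite_Ioo)
qed

definition ridge_U :: "nat \<Rightarrow> real \<Rightarrow> real \<times> real \<Rightarrow> real" where
  "ridge_U k \<theta> = (\<lambda>(x, y). poly (cheb_U k) (x * cos \<theta> + y * sin \<theta>))"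

text \<open>In the following four definitions the argument \<open>m\<close> stands for the even order $2m$;
  in particular \<open>A_op m\<close> is $\mathcal{A}_{2m}$.\<close>

definition phi :: "nat \<Rightarrow> nat \<Rightarrow> real" where
  "phi m \<nu> = 2 * pi * real \<nu> / real (2 * m + 1)"

definition theta :: "nat \<Rightarrow> nat \<Rightarrow> real" where
  "theta m j = real j * pi / real (2 * m + 1)"

definition T_fun :: "nat \<Rightarrow> nat \<Rightarrow> nat \<Rightarrow> real \<times> real \<Rightarrow> real" where
  "T_fun m j \<nu> p = 1 / (real (2 * m + 1))\<^sup>2 *
     (\<Sum>k = 0..2 * m. real (k + 1) * sin (real (k + 1) * theta m j) * ridge_U k (phi m \<nu>) p)"

definition A_op :: "nat \<Rightarrow> (real \<times> real \<Rightarrow> real) \<Rightarrow> real \<times> real \<Rightarrow> real" where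
  "A_op m f p =
     (\<Sum>\<nu> = 0..2 * m. \<Sum>j = 1..2 * m. radon (phi m \<nu>) f (cos (theta m j)) * T_fun m j \<nu> p)"

text \<open>The elements of $C(B^2)$ are represented by functions on the whole plane that are
  continuous on the disc; only their values on the disc enter below.\<close>

definition C_B2 :: "(real \<times> real \<Rightarrow> real) set" where
  "C_B2 = {f. continuous_on B2 f}"

lemma A_op_in_C_B2: "A_op m f \<in> C_B2"
  unfolding C_B2_def A_op_def T_fun_def ridge_U_def case_prod_beta
  by (auto intro!: continuous_intros)

lemma A_op_cong:
  assumes "\<And>p. p \<in> B2 \<Longrightarrow> f p = g p"
  shows "A_op m f = A_op m g"
proof -
  have "radon \<theta> f t = radon \<theta> g t" if "\<bar>t\<bar> \<le> 1" for \<theta> t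
    unfolding radon_def
  proof (rule integral_cong)
    fix s assume "s \<in> {- sqrt (1 - t\<^sup>2)..sqrt (1 - t\<^sup>2)}"
    then have "\<bar>s\<bar> \<le> sqrt (1 - t\<^sup>2)" by auto
    then have "s\<^sup>2 \<le> 1 - t\<^sup>2"
      using sqrt_ge_absD by blast
    moreover have "(t * cos \<theta> - s * sin \<theta>)\<^sup>2 + (t * sin \<theta> + s * cos \<theta>)\<^sup>2
        = (t\<^sup>2 + s\<^sup>2) * ((sin \<theta>)\<^sup>2 + (cos \<theta>)\<^sup>2)"
      by (simp only: power2_eq_square) algebra
    ultimately show "f (t * cos \<theta> - s * sin \<theta>, t * sin \<theta> + s * cos \<theta>)
        = g (t * cos \<theta> - s * sin \<theta>, t * sin \<theta> + s * cos \<theta>)"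
      by (intro assms) (simp add: B2_def)
  qed
  then show ?thesis unfolding A_op_def by (simp add: fun_eq_iff)
qed

text \<open>Both suprema are taken in the extended reals, so that no boundedness is presupposed:
  an unbounded operator has norm infinity.\<close>

definition unif_norm :: "(real \<times> real \<Rightarrow> real) \<Rightarrow> ereal" where
  "unif_norm f = (SUP p\<in>B2. ereal \<bar>f p\<bar>)"

definition op_norm :: "((real \<times> real \<Rightarrow> real) \<Rightarrow> real \<times> real \<Rightarrow> real) \<Rightarrow> ereal" where
  "op_norm L = (SUP f\<in>{f \<in> C_B2. unif_norm f \<le> 1}. unif_norm (L f))"

end

theory Submission
  imports Defs
begin

text \<open>
  With \<open>N = 2m + 1\<close>, the chord of the ray \<open>(j, \<nu>)\<close> has length \<open>2 sin \<theta>\<^sub>j\<close>, and any two of the finitely many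
  rays meet in at most one point. Hence continuous functions can prescribe the signs on all rays at
  once, and the operator norm is \<open>2 sup\<^sub>p \<Lambda>(p)\<close> with \<open>\<Lambda>(p) = \<Sum>\<^sub>\<nu>\<^sub>,\<^sub>j sin \<theta>\<^sub>j \<bar>T\<^sub>j\<^sub>,\<^sub>\<nu>(p)\<bar>\<close>.

  Let \<open>\<psi>\<close> be the angle with \<open>cos \<psi> = x cos \<phi>\<^sub>\<nu> + y sin \<phi>\<^sub>\<nu>\<close>. Since \<open>sin (N\<theta>\<^sub>j) = 0\<close>, the leading terms in
  the closed form of \<open>\<Sum> k sin (k\<theta>\<^sub>j) sin (k\<psi>)\<close> cancel, so that, up to a constant factor,
  \<open>sin \<theta>\<^sub>j \<bar>T\<^sub>j\<^sub>,\<^sub>\<nu>\<bar>\<close> is at most \<open>1/N\<close> times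
  \<open>min (N, 1 / \<bar>sin ((\<theta>\<^sub>j - \<psi>)/2)\<bar>) + min (N, 1 / sin \<psi>)\<close>. As \<open>sin \<psi> \<ge> \<bar>sin (\<phi>\<^sub>\<nu> - \<beta>)\<bar>\<close> for the polar
  angle \<open>\<beta>\<close> of \<open>p\<close>, both terms are sampled at equally spaced angles, which gives harmonic sums and
  \<open>\<Lambda>(p) = O(N log N)\<close>.

  At the origin \<open>\<psi> = \<pi>/2\<close> for every \<open>\<nu>\<close>, and the same closed form bounds \<open>\<bar>T\<^sub>j\<^sub>,\<^sub>\<nu>\<bar>\<close> from below by a multiple
  of \<open>tan (\<theta>\<^sub>j) / N\<close> for \<open>\<theta>\<^sub>j < \<pi>/2\<close>; the points near \<open>\<pi>/2\<close> again produce a harmonic sum.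
\<close>

section \<open>Sums of truncated cosecants\<close>

text \<open>Concavity of the sine on [0, pi] together with sin 0 = 0, phrased as convexity of the
  negated sine. It yields Jordan's inequality and, later, a bound for sin (pi / (2N)).\<close>

lemma sin_scale_ge:
  fixes a t :: real
  assumes "0 \<le> t" "t \<le> 1" "0 \<le> a" "a \<le> pi"
  shows "t * sin a \<le> sin (t * a)"
proof -
  have "convex_on {0..pi} (\<lambda>x. - sin x)"
  proof (rule f''_ge0_imp_convex)
    show "((\<lambda>x. - sin x) has_real_derivative - cos x) (at x)" for x :: real
      by (auto intro!: derivative_eq_intros)
    show "((\<lambda>x. - cos x) has_real_derivative sin x) (at x)" for x :: real
      by (auto intro!: derivative_eq_intros)
  qed (auto simp: sin_ge_zero)
  from convex_onD[OF this assms(1,2), of 0 a] show ?thesis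
    using assms by simp
qed

lemma Jordan_inequality:
  fixes x :: real
  assumes "0 \<le> x" "x \<le> pi / 2"
  shows "2 * x / pi \<le> sin x"
  using sin_scale_ge[of "2 * x / pi" "pi / 2"] assms by simp

text \<open>This is \<open>min (M, 1 / \<bar>sin x\<bar>)\<close>, written so that \<open>1 / 0 = 0\<close> does no harm at the zeros of the sine.\<close>

definition peak :: "nat \<Rightarrow> real \<Rightarrow> real" where
  "peak M x = 1 / max (1 / real M) \<bar>sin x\<bar>"

lemma peak_nonneg: "0 \<le> peak M x"
  unfolding peak_def by simp

lemma peak_add_pi [simp]: "peak M (x + pi) = peak M x"
  unfolding peak_def by simp

lemma peak_antimono:
  assumes "M > 0" "\<bar>sin y\<bar> \<le> \<bar>sin x\<bar>"
  shows "peak M x \<le> peak M y"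
  unfolding peak_def using assms by (intro divide_left_mono) (auto simp: less_max_iff_disj)

text \<open>Here x lies in cell i of the M cells of length pi / M. By Jordan's inequality, measured
  from the nearer end of [0, pi], \<open>\<bar>sin x\<bar>\<close> is at least 2k / M, where k is
  the number of whole cells in between: i on the left half, M - Suc i on the right. Adding the two
  resulting bounds avoids a case split when summing.\<close>

lemma peak_le:
  assumes "M > 0" "0 \<le> x" "x < pi" "i < M" "i * pi / M \<le> x" "x \<le> (i + 1) * pi / M"
  shows "peak M x \<le> M * (inverse (real (Suc i)) + inverse (real (Suc (M - Suc i))))"
proof -
  have M: "real M > 0" using assms by simp
  \<comment> \<open>For k = 0 the cap 1 / M in \<open>peak\<close> already suffices; for k > 0, 2k
    is at least k + 1.\<close>
  have key: "peak M x \<le> M * inverse (real (Suc k))" if "2 * real k / M \<le> \<bar>sin x\<bar>" for k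
  proof -
    have "real (Suc k) / M \<le> max (1 / real M) \<bar>sin x\<bar>"
    proof (cases "k = 0")
      case False
      then have "real (Suc k) / M \<le> 2 * real k / M"
        using M by (intro divide_right_mono) auto
      with that show ?thesis by linarith
    qed auto
    then have "peak M x \<le> 1 / (real (Suc k) / M)"
      unfolding peak_def using M by (intro divide_left_mono) (auto simp: less_max_iff_disj)
    then show ?thesis by (simp add: field_simps)
  qed
  have pos: "0 \<le> M * inverse (real (Suc k))" for k
    using M by simp
  show ?thesis
  proof (cases "x \<le> pi / 2")
    case True
    have "2 * real i / M = 2 * (i * pi / M) / pi" by simp
    also have "\<dots> \<le> 2 * x / pi" using assms by (intro divide_right_mono) auto
    also have "\<dots> \<le> \<bar>sin x\<bar>" using Jordan_inequality[of x] True assms by linarith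
    finally show ?thesis unfolding distrib_left using key[of i] pos[of "M - Suc i"] by linarith
  next
    case False
    have "2 * real (M - Suc i) / M = 2 * (pi - (i + 1) * pi / M) / pi"
      using M assms by (simp add: of_nat_diff field_simps)
    also have "\<dots> \<le> 2 * (pi - x) / pi"
      using assms(6) by (intro divide_right_mono mult_left_mono diff_left_mono)
        (auto simp: add.commute)
    also have "\<dots> \<le> \<bar>sin x\<bar>" using Jordan_inequality[of "pi - x"] False assms by simp
    finally show ?thesis unfolding distrib_left using key[of "M - Suc i"] pos[of i] by linarith
  qed
qed

text \<open>M steps of the grid make one period pi, so moving by one step only replaces the first
  sample by an equal one at the other end.\<close>

lemma sum_peak_shift:
  assumes "M > 0"
  shows "(\<Sum>i<M. peak M (\<alpha> + real k * pi / M + real i * pi / M)) = (\<Sum>i<M. peak M (\<alpha> + real i * pi / M))"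
proof (induction k)
  case (Suc k)
  let ?h = "\<lambda>i. peak M (\<alpha> + real k * pi / M + real i * pi / M)"
  have "(\<Sum>i<M. peak M (\<alpha> + real (Suc k) * pi / M + real i * pi / M)) = (\<Sum>i<M. ?h (Suc i))"
    by (simp add: algebra_simps add_divide_distrib)
  also have "\<dots> = (\<Sum>i<Suc M. ?h i) - ?h 0"
    by (subst sum.lessThan_Suc_shift) simp
  also have "\<dots> = (\<Sum>i<M. ?h i) + (?h M - ?h 0)" by simp
  also have "?h M = ?h 0" using assms peak_add_pi[of M "\<alpha> + real k * pi / M"] by simp
  finally show ?case using Suc by simp
qed simp

lemma sum_peak_le:
  assumes "M > 0"
  shows "(\<Sum>i<M. peak M (\<alpha> + real i * pi / M)) \<le> 2 * real M * harm M"
proof -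
  \<comment> \<open>Remove the whole grid steps from the offset, so that each cell of [0, pi)
    contains exactly one sample. As q may be negative while shifts are natural numbers, the shift is
    applied in either direction.\<close>
  define q where "q = \<lfloor>\<alpha> * M / pi\<rfloor>"
  define a where "a = \<alpha> - real_of_int q * pi / M"
  have M: "real M > 0" using assms by simp
  have q: "real_of_int q \<le> \<alpha> * M / pi" "\<alpha> * M / pi < real_of_int q + 1"
    unfolding q_def by linarith+
  have "q * pi / M \<le> \<alpha>" "\<alpha> < (q + 1) * pi / M"
    using q M by (simp_all add: pos_divide_le_eq pos_le_divide_eq pos_less_divide_eq pos_divide_less_eq)
  then have a: "0 \<le> a" "a < pi / M"
    unfolding a_def by (simp_all add: add_divide_distrib distrib_right)
  have shift: "(\<Sum>i<M. peak M (\<alpha> + real i * pi / M)) = (\<Sum>i<M. peak M (a + real i * pi / M))"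
  proof (cases "0 \<le> q")
    case True
    then have "\<alpha> = a + real (nat q) * pi / M" by (simp add: a_def)
    then show ?thesis using sum_peak_shift[OF assms, of a "nat q"] by simp
  next
    case False
    then have "a = \<alpha> + real (nat (- q)) * pi / M" by (simp add: a_def)
    then show ?thesis using sum_peak_shift[OF assms, of \<alpha> "nat (- q)"] by simp
  qed
  have "(\<Sum>i<M. peak M (a + real i * pi / M))
      \<le> (\<Sum>i<M. M * (inverse (real (Suc i)) + inverse (real (Suc (M - Suc i)))))"
  proof (rule sum_mono)
    fix i assume "i \<in> {..<M}"
    then have i: "i < M" by simp
    have le: "a + real i * pi / M < (i + 1) * pi / M"
      using a by (simp add: distrib_right add_divide_distrib)
    also have "\<dots> \<le> real M * pi / M" using i by (intro divide_right_mono mult_right_mono) auto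
    also have "\<dots> = pi" using M by simp
    finally show "peak M (a + real i * pi / M)
        \<le> M * (inverse (real (Suc i)) + inverse (real (Suc (M - Suc i))))"
      using le i a assms by (intro peak_le) (auto simp: add.commute)
  qed
  also have "\<dots> = M * ((\<Sum>i<M. inverse (real (Suc i))) + (\<Sum>i<M. inverse (real (Suc (M - Suc i)))))"
    by (simp only: sum_distrib_left[symmetric] sum.distrib)
  also have "(\<Sum>i<M. inverse (real (Suc (M - Suc i)))) = (\<Sum>i<M. inverse (real (Suc i)))"
    by (rule sum.nat_diff_reindex)
  finally show ?thesis unfolding shift by (simp add: harm_altdef)
qed

lemma harm_le_ln:
  assumes "n > 0"
  shows "harm n \<le> 1 + ln (real n)"
  using assms
proof (induction n rule: nat_induct_non_zero)
  case 1
  show ?case by (simp add: harm_expand)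
next
  case (Suc n)
  \<comment> \<open>Since 1 / (n + 1) = 1 - n / (n + 1), this bounds each harmonic term by a
    difference of logarithms.\<close>
  have "ln (real n / real (Suc n)) \<le> real n / real (Suc n) - 1"
    using Suc.hyps by (intro ln_le_minus_one) auto
  then have "inverse (real (Suc n)) \<le> ln (real (Suc n)) - ln (real n)"
    using Suc.hyps by (simp add: ln_div field_simps)
  with Suc.IH show ?case by (simp add: harm_Suc)
qed

section \<open>The Chebyshev kernel\<close>

text \<open>This is the addition formula for the sine divided by \<open>sin \<psi>\<close>.
  Induction along the recursion avoids the division, so zeros of the sine are covered.\<close>

lemma cheb_U_Suc_cos:
  "poly (cheb_U (Suc k)) (cos \<psi>) = cos \<psi> * poly (cheb_U k) (cos \<psi>) + cos (real (Suc k) * \<psi>)"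
proof (induction k)
  case (Suc k)
  let ?U = "\<lambda>k. poly (cheb_U k) (cos \<psi>)"
  define a where "a = real (Suc k) * \<psi>"
  have U: "?U k * sin \<psi> = sin a"
    using cheb_U_cos_mult[of k \<psi>] by (simp add: a_def)
  have IH: "?U (Suc k) = cos \<psi> * ?U k + cos a"
    using Suc by (simp add: a_def)
  have "cos \<psi> * ?U (Suc k) - ?U k = cos \<psi> * cos a - (1 - (cos \<psi>)\<^sup>2) * ?U k"
    unfolding IH by (simp add: algebra_simps power2_eq_square)
  also have "(1 - (cos \<psi>)\<^sup>2) * ?U k = sin \<psi> * sin a"
    unfolding U[symmetric] sin_squared_eq[symmetric] by (simp add: power2_eq_square)
  also have "cos \<psi> * cos a - sin \<psi> * sin a = cos (real (Suc (Suc k)) * \<psi>)"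
    by (simp add: a_def cos_add[symmetric] algebra_simps)
  finally show ?case by simp
qed simp

lemma abs_cheb_U_cos_le: "\<bar>poly (cheb_U k) (cos \<psi>)\<bar> \<le> real k + 1"
proof (induction k)
  case (Suc k)
  have "\<bar>cos \<psi> * poly (cheb_U k) (cos \<psi>)\<bar> \<le> 1 * \<bar>poly (cheb_U k) (cos \<psi>)\<bar>"
    unfolding abs_mult by (intro mult_right_mono) auto
  then show ?case
    using Suc abs_cos_le_one[of "real (Suc k) * \<psi>"] unfolding cheb_U_Suc_cos of_nat_Suc by linarith
qed simp

definition cheb_kernel :: "nat \<Rightarrow> real \<Rightarrow> real \<Rightarrow> real" where
  "cheb_kernel n \<theta> x = (\<Sum>k = 0..n. real (k + 1) * sin (real (k + 1) * \<theta>) * poly (cheb_U k) x)"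

text \<open>Since \<open>2 sin \<theta> sin (k \<theta>) = cos ((k - 1) \<theta>) - cos ((k + 1) \<theta>)\<close>, summation by parts replaces the
  coefficients \<open>c\<^sub>k = k U\<^bsub>k-1\<^esub>\<close>, of size \<open>k\<^sup>2\<close>, by the differences \<open>c\<^bsub>k+1\<^esub> - c\<^bsub>k-1\<^esub>\<close>, of size \<open>k\<close> only.\<close>

lemma sin_mult_cheb_kernel_le:
  "\<bar>sin \<theta> * cheb_kernel n \<theta> (cos \<psi>)\<bar> \<le> 2 * (real n + 1)\<^sup>2"
proof -
  define c where "c k = real k * poly (cheb_U (k - 1)) (cos \<psi>)" for k
  have c_Suc: "c (Suc k) = (real k + 1) * poly (cheb_U k) (cos \<psi>)" for k
    by (simp add: c_def)
  have c_le: "\<bar>c k\<bar> \<le> (real k)\<^sup>2" for k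
  proof (cases k)
    case (Suc i)
    have "\<bar>c (Suc i)\<bar> \<le> (real i + 1) * (real i + 1)"
      unfolding c_Suc abs_mult by (intro mult_mono abs_cheb_U_cos_le) auto
    with Suc show ?thesis by (simp add: power2_eq_square add.commute)
  qed (simp add: c_def)
  have gap: "\<bar>c (Suc (Suc k)) - c k\<bar> \<le> 4 * (real k + 1)" for k
  proof (cases k)
    case 0
    then show ?thesis by (simp add: c_def abs_mult)
  next
    case (Suc i)
    let ?U = "\<lambda>k. poly (cheb_U k) (cos \<psi>)"
    have U2: "?U i = 2 * cos \<psi> * ?U (Suc i) - ?U (Suc (Suc i))" by simp
    define a b where "a = 2 * (real k + 1) * cos (real (Suc (Suc i)) * \<psi>)" and "b = cos \<psi> * ?U (Suc i)"
    \<comment> \<open>The coefficients of the two Chebyshev values differ by 2 only, so the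
      quadratic parts cancel and a term of size k remains.\<close>
    have "c (Suc (Suc k)) - c k = a + 2 * b"
      unfolding Suc c_Suc U2 cheb_U_Suc_cos[of "Suc i"] a_def b_def by (simp add: algebra_simps)
    then have "\<bar>c (Suc (Suc k)) - c k\<bar> \<le> \<bar>a\<bar> + 2 * \<bar>b\<bar>"
      using abs_triangle_ineq[of a "2 * b"] by simp
    also have "\<bar>a\<bar> \<le> 2 * (real k + 1) * 1"
      unfolding a_def abs_mult by (intro mult_mono) auto
    also have "\<bar>b\<bar> \<le> 1 * (real (Suc i) + 1)"
      unfolding b_def abs_mult by (intro mult_mono abs_cheb_U_cos_le) auto
    finally show ?thesis using Suc by simp
  qed
  \<comment> \<open>E is what summation by parts leaves after moving the two boundary terms to the
    left: E 0 = c 1 = 1, and each step adds one difference c (n + 2) - c n times a cosine.\<close>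
  define E where "E n = 2 * (sin \<theta> * cheb_kernel n \<theta> (cos \<psi>))
      + c (Suc n) * cos (real (n + 2) * \<theta>) + c n * cos (real (n + 1) * \<theta>)" for n
  have "\<bar>E n\<bar> \<le> 2 * (real n + 1)\<^sup>2"
  proof (induction n)
    case 0
    have "E 0 = 1"
      using cos_double[of \<theta>] sin_cos_squared_add[of \<theta>]
      by (simp add: E_def c_def cheb_kernel_def power2_eq_square)
    then show ?case by simp
  next
    case (Suc n)
    define a where "a = real (n + 2) * \<theta>"
    have kern: "cheb_kernel (Suc n) \<theta> (cos \<psi>) = cheb_kernel n \<theta> (cos \<psi>) + sin a * c (Suc (Suc n))"
      unfolding c_Suc cheb_kernel_def a_def by (simp add: mult_ac)
    have eqs: "real (Suc n + 2) * \<theta> = a + \<theta>" "real (n + 1) * \<theta> = a - \<theta>" "real (Suc n + 1) * \<theta> = a"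
      by (simp_all add: a_def algebra_simps)
    have "E (Suc n) = E n + (c (Suc (Suc n)) - c n) * cos (real (n + 1) * \<theta>)"
      unfolding E_def kern eqs a_def[symmetric] by (simp add: cos_add cos_diff algebra_simps)
    moreover have "\<bar>(c (Suc (Suc n)) - c n) * cos (real (n + 1) * \<theta>)\<bar> \<le> 4 * (real n + 1) * 1"
      unfolding abs_mult by (intro mult_mono gap) auto
    ultimately have "\<bar>E (Suc n)\<bar> \<le> 2 * (real n + 1)\<^sup>2 + 4 * (real n + 1)"
      using Suc by linarith
    also have "\<dots> \<le> 2 * (real (Suc n) + 1)\<^sup>2"
      by (simp add: power2_eq_square algebra_simps)
    finally show ?case .
  qed
  moreover have "\<bar>c (Suc n) * cos (real (n + 2) * \<theta>)\<bar> \<le> (real n + 1)\<^sup>2 * 1"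
    unfolding abs_mult using c_le[of "Suc n"] by (intro mult_mono) (auto simp: add.commute)
  moreover have "\<bar>c n * cos (real (n + 1) * \<theta>)\<bar> \<le> (real n + 1)\<^sup>2 * 1"
  proof -
    have "(real n)\<^sup>2 \<le> (real n + 1)\<^sup>2" by (intro power_mono) auto
    then show ?thesis
      unfolding abs_mult using order_trans[OF c_le[of n]] by (intro mult_mono) auto
  qed
  ultimately show ?thesis unfolding E_def by linarith
qed

section \<open>Closed form of the kernel at the nodes\<close>

lemma sum_nat_mult_cos:
  fixes \<alpha> :: real
  shows "4 * (sin (\<alpha> / 2))\<^sup>2 * (\<Sum>k = 0..n. real (k + 1) * cos (real (k + 1) * \<alpha>))
    = real (n + 2) * cos (real (n + 1) * \<alpha>) - real (n + 1) * cos (real (n + 2) * \<alpha>) - 1"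
proof -
  \<comment> \<open>Multiplying by \<open>2 - 2 * cos \<alpha>\<close> takes a negated second
    difference of the cosines. The coefficients k are linear, so only boundary terms
    survive.\<close>
  have s: "4 * (sin (\<alpha> / 2))\<^sup>2 = 2 - 2 * cos \<alpha>"
    using cos_double_sin[of "\<alpha> / 2"] by simp
  show ?thesis unfolding s
  proof (induction n)
    case 0
    show ?case using cos_double_cos[of \<alpha>] by (simp add: algebra_simps power2_eq_square)
  next
    case (Suc n)
    define a where "a = real (n + 2) * \<alpha>"
    have eq: "real (Suc n + 2) * \<alpha> = a + \<alpha>" "real (n + 1) * \<alpha> = a - \<alpha>" "real (Suc n + 1) * \<alpha> = a"
      by (simp_all add: a_def algebra_simps)
    show ?case
      using Suc unfolding sum.atLeast0_atMost_Suc distrib_left eq a_def[symmetric]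
      by (simp add: cos_add cos_diff algebra_simps)
  qed
qed

lemma sum_nat_mult_cos_closed:
  fixes \<alpha> :: real and n :: nat
  assumes "sin (\<alpha> / 2) \<noteq> 0"
  defines "N \<equiv> real (n + 1)"
  shows "(\<Sum>k = 0..n. real (k + 1) * cos (real (k + 1) * \<alpha>))
    = N / 2 * cos (N * \<alpha>) + N / 2 * sin (N * \<alpha>) * (cos (\<alpha> / 2) / sin (\<alpha> / 2))
      - (1 - cos (N * \<alpha>)) / (4 * (sin (\<alpha> / 2))\<^sup>2)"
proof -
  let ?S = "\<Sum>k = 0..n. real (k + 1) * cos (real (k + 1) * \<alpha>)"
  let ?s = "sin (\<alpha> / 2)"
  have c: "cos \<alpha> = 1 - 2 * ?s\<^sup>2" and s: "sin \<alpha> = 2 * ?s * cos (\<alpha> / 2)"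
    using cos_double_sin[of "\<alpha> / 2"] sin_double[of "\<alpha> / 2"] by simp_all
  have e: "(N + 1) * \<alpha> = N * \<alpha> + \<alpha>" "real (n + 2) = N + 1" "real (n + 1) = N"
    by (simp_all add: N_def algebra_simps)
  have "4 * ?s\<^sup>2 * ?S = (N + 1) * cos (N * \<alpha>) - N * cos (N * \<alpha> + \<alpha>) - 1"
    using sum_nat_mult_cos[of \<alpha> n] by (simp only: e)
  also have "\<dots> = 4 * ?s\<^sup>2 * (N / 2 * cos (N * \<alpha>) + N / 2 * sin (N * \<alpha>) * (cos (\<alpha> / 2) / ?s)
      - (1 - cos (N * \<alpha>)) / (4 * ?s\<^sup>2))"
    using assms unfolding cos_add c s by (simp add: field_simps power2_eq_square)
  finally show ?thesis using assms by simp
qed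

lemma sin_mult_cheb_kernel_eq:
  "2 * (sin \<psi> * cheb_kernel n \<theta> (cos \<psi>))
    = (\<Sum>k = 0..n. real (k + 1) * cos (real (k + 1) * (\<theta> - \<psi>)))
      - (\<Sum>k = 0..n. real (k + 1) * cos (real (k + 1) * (\<theta> + \<psi>)))"
proof -
  have "2 * (sin \<psi> * (real (k + 1) * sin (real (k + 1) * \<theta>) * poly (cheb_U k) (cos \<psi>)))
      = real (k + 1) * cos (real (k + 1) * (\<theta> - \<psi>)) - real (k + 1) * cos (real (k + 1) * (\<theta> + \<psi>))" for k
  proof -
    have "2 * (sin \<psi> * (real (k + 1) * sin (real (k + 1) * \<theta>) * poly (cheb_U k) (cos \<psi>)))
        = 2 * real (k + 1) * sin (real (k + 1) * \<theta>) * (poly (cheb_U k) (cos \<psi>) * sin \<psi>)"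
      by (simp only: mult_ac)
    also have "\<dots> = real (k + 1) * (2 * (sin (real (k + 1) * \<theta>) * sin (real (k + 1) * \<psi>)))"
      unfolding cheb_U_cos_mult by (simp only: mult_ac)
    also have "\<dots> = real (k + 1) * (cos (real (k + 1) * \<theta> - real (k + 1) * \<psi>) - cos (real (k + 1) * \<theta> + real (k + 1) * \<psi>))"
      by (simp add: cos_diff cos_add)
    finally show ?thesis by (simp only: right_diff_distrib distrib_left)
  qed
  then show ?thesis
    unfolding cheb_kernel_def sum_distrib_left by (simp only: sum_subtractf)
qed

text \<open>As \<open>sin (N * \<theta>) = 0\<close>, the cosines of
  \<open>N * (\<theta> - \<psi>)\<close> and \<open>N * (\<theta> + \<psi>)\<close> agree, while the
  sines are opposite. So the terms N/2 cos cancel in the difference of the two sums, and the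
  cotangents of u and v add up to \<open>sin \<theta> / (sin u * sin v)\<close>.\<close>

lemma sin_mult_cheb_kernel_closed:
  fixes n :: nat and \<theta> \<psi> :: real
  defines "N \<equiv> real (n + 1)" and "u \<equiv> (\<theta> + \<psi>) / 2" and "v \<equiv> (\<theta> - \<psi>) / 2"
  assumes N\<theta>: "sin (N * \<theta>) = 0" and u: "sin u \<noteq> 0" and v: "sin v \<noteq> 0"
  shows "2 * (sin \<psi> * cheb_kernel n \<theta> (cos \<psi>))
    = - (N / 2 * (cos (N * \<theta>) * sin (N * \<psi>)) * (sin \<theta> / (sin u * sin v)))
      - (1 - cos (N * \<theta>) * cos (N * \<psi>)) / 4 * (1 / (sin v)\<^sup>2 - 1 / (sin u)\<^sup>2)"
proof -
  define C S where "C = cos (N * \<theta>) * cos (N * \<psi>)" and "S = cos (N * \<theta>) * sin (N * \<psi>)"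
  have cC: "cos (N * (\<theta> - \<psi>)) = C" "cos (N * (\<theta> + \<psi>)) = C"
    and sS: "sin (N * (\<theta> - \<psi>)) = - S" "sin (N * (\<theta> + \<psi>)) = S"
    using N\<theta> by (simp_all add: C_def S_def right_diff_distrib distrib_left cos_add cos_diff sin_add sin_diff)
  have uv: "u + v = \<theta>" by (simp add: u_def v_def field_simps)
  have "sin ((\<theta> - \<psi>) / 2) \<noteq> 0" "sin ((\<theta> + \<psi>) / 2) \<noteq> 0" using u v by (simp_all add: u_def v_def)
  note closed = this[THEN sum_nat_mult_cos_closed[of _ n], folded N_def u_def v_def, unfolded cC sS]
  have "2 * (sin \<psi> * cheb_kernel n \<theta> (cos \<psi>))
      = - (N / 2 * S * (cos v / sin v + cos u / sin u)) - (1 - C) / 4 * (1 / (sin v)\<^sup>2 - 1 / (sin u)\<^sup>2)"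
    unfolding sin_mult_cheb_kernel_eq closed by (simp add: algebra_simps)
  also have "cos v / sin v + cos u / sin u = sin \<theta> / (sin u * sin v)"
    unfolding uv[symmetric] sin_add using u v by (simp add: field_simps)
  finally show ?thesis unfolding C_def S_def .
qed

lemma sin_squared_diff:
  fixes u v :: real
  shows "(sin u)\<^sup>2 - (sin v)\<^sup>2 = sin (u + v) * sin (u - v)"
  using sin_cos_squared_add[of u] sin_cos_squared_add[of v] unfolding sin_add sin_diff by algebra

text \<open>From \<open>sin_squared_diff\<close>, (sin u)^2 - (sin v)^2 =
  \<open>sin \<theta> * sin \<psi>\<close> is positive. The difference of the reciprocal squares is
  thus nonnegative and at most 1 / (sin v)^2.\<close>

lemma cheb_kernel_le:
  fixes n :: nat and \<theta> \<psi> :: real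
  defines "N \<equiv> real (n + 1)" and "u \<equiv> (\<theta> + \<psi>) / 2" and "v \<equiv> (\<theta> - \<psi>) / 2"
  assumes \<theta>: "0 < \<theta>" "\<theta> < pi" "sin (N * \<theta>) = 0"
    and \<psi>: "0 < \<psi>" "\<psi> < pi" and v: "sin v \<noteq> 0"
  shows "\<bar>sin \<psi> * cheb_kernel n \<theta> (cos \<psi>)\<bar>
    \<le> N * sin \<theta> / (4 * sin u * \<bar>sin v\<bar>) + 1 / (2 * (sin v)\<^sup>2)"
proof -
  have N: "N > 0" by (simp add: N_def)
  have u: "sin u > 0" unfolding u_def using \<theta> \<psi> by (intro sin_gt_zero) auto
  have sin\<theta>: "sin \<theta> > 0" "sin \<psi> > 0" using \<theta> \<psi> by (auto intro: sin_gt_zero)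
  have uv: "u + v = \<theta>" "u - v = \<psi>" by (simp_all add: u_def v_def field_simps)
  have vu: "(sin v)\<^sup>2 \<le> (sin u)\<^sup>2"
    using sin_squared_diff[of u v] mult_pos_pos[OF sin\<theta>] unfolding uv by linarith
  define C S where "C = cos (N * \<theta>) * cos (N * \<psi>)" and "S = cos (N * \<theta>) * sin (N * \<psi>)"
  define d where "d = 1 / (sin v)\<^sup>2 - 1 / (sin u)\<^sup>2"
  have d: "0 \<le> d" "d \<le> 1 / (sin v)\<^sup>2"
    using vu v u by (auto simp: d_def intro!: divide_left_mono)
  have S: "\<bar>S\<bar> \<le> 1" unfolding S_def abs_mult by (intro mult_le_one) auto
  have C: "\<bar>C\<bar> \<le> 1" unfolding C_def abs_mult by (intro mult_le_one) auto
  have eq: "2 * (sin \<psi> * cheb_kernel n \<theta> (cos \<psi>))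
      = - (N / 2 * S * (sin \<theta> / (sin u * sin v))) - (1 - C) / 4 * d"
    using sin_mult_cheb_kernel_closed[of n \<theta> \<psi>] \<theta>(3) u v
    unfolding N_def u_def v_def C_def S_def d_def by simp
  have "\<bar>N / 2 * S * (sin \<theta> / (sin u * sin v))\<bar> \<le> N / 2 * 1 * (sin \<theta> / (sin u * \<bar>sin v\<bar>))"
    unfolding abs_mult using N S u sin\<theta> by (intro mult_mono) (auto simp: abs_mult)
  moreover have "\<bar>(1 - C) / 4 * d\<bar> \<le> 1 * (1 / (sin v)\<^sup>2)"
    unfolding abs_mult using C d by (intro mult_mono) auto
  ultimately have "\<bar>2 * (sin \<psi> * cheb_kernel n \<theta> (cos \<psi>))\<bar>
      \<le> N / 2 * 1 * (sin \<theta> / (sin u * \<bar>sin v\<bar>)) + 1 * (1 / (sin v)\<^sup>2)"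
    unfolding eq by (intro order_trans[OF abs_triangle_ineq4] add_mono) auto
  then have "\<bar>sin \<psi> * cheb_kernel n \<theta> (cos \<psi>)\<bar> \<le> (N / 2 * (sin \<theta> / (sin u * \<bar>sin v\<bar>)) + 1 / (sin v)\<^sup>2) / 2"
    by (simp add: abs_mult)
  also have "\<dots> = N * sin \<theta> / (4 * sin u * \<bar>sin v\<bar>) + 1 / (2 * (sin v)\<^sup>2)"
    by (simp add: add_divide_distrib)
  finally show ?thesis .
qed

section \<open>Upper bound for the Lebesgue function\<close>

text \<open>If one of the peaks is at its cap, the crude bound 2 N^2 is enough. Otherwise the closed
  form applies, and the weight \<open>sin \<theta>\<close> splits the product of 1 /
  \<open>\<bar>sin v\<bar>\<close> and \<open>1 / sin \<psi>\<close> into a sum. The cap 2N for v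
  fits the half angles, whose spacing is pi / (2N).\<close>

lemma sin_mult_cheb_kernel_le_peak:
  fixes n :: nat and \<theta> \<psi> :: real
  defines "N \<equiv> real (n + 1)"
  assumes \<theta>: "0 < \<theta>" "\<theta> < pi" "sin (N * \<theta>) = 0" and \<psi>: "0 \<le> \<psi>" "\<psi> \<le> pi"
  shows "sin \<theta> * \<bar>cheb_kernel n \<theta> (cos \<psi>)\<bar>
    \<le> 3 * N * (peak (2 * (n + 1)) ((\<theta> - \<psi>) / 2) + peak (n + 1) \<psi>)"
proof -
  have N: "N > 0" "real (2 * (n + 1)) = 2 * N" by (simp_all add: N_def)
  define u v where "u = (\<theta> + \<psi>) / 2" and "v = (\<theta> - \<psi>) / 2"
  have pk: "0 \<le> peak (2 * (n + 1)) v" "0 \<le> peak (n + 1) \<psi>" by (rule peak_nonneg)+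
  have sin\<theta>: "sin \<theta> > 0" using \<theta> by (auto intro: sin_gt_zero)
  have sin\<psi>: "sin \<psi> \<ge> 0" using \<psi> by (intro sin_ge_zero)
  have trivial: "sin \<theta> * \<bar>cheb_kernel n \<theta> (cos \<psi>)\<bar> \<le> 2 * N\<^sup>2"
    using sin_mult_cheb_kernel_le[of \<theta> n \<psi>] sin\<theta> by (simp add: N_def abs_mult add.commute)
  consider "sin \<psi> \<le> 1 / N" | "\<bar>sin v\<bar> \<le> 1 / (2 * N)" | "1 / N < sin \<psi>" "1 / (2 * N) < \<bar>sin v\<bar>"
    by linarith
  then have "sin \<theta> * \<bar>cheb_kernel n \<theta> (cos \<psi>)\<bar> \<le> 3 * N * (peak (2 * (n + 1)) v + peak (n + 1) \<psi>)"
  proof cases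
    case 1
    then have "peak (n + 1) \<psi> = N"
      using sin\<psi> N unfolding peak_def N_def[symmetric] by (simp add: max_def)
    then have "3 * N * (0 + N) \<le> 3 * N * (peak (2 * (n + 1)) v + peak (n + 1) \<psi>)"
      using pk N by (intro mult_left_mono add_mono) auto
    moreover have "2 * N\<^sup>2 \<le> 3 * N * (0 + N)" by (simp add: power2_eq_square)
    ultimately show ?thesis using trivial by (meson order_trans)
  next
    case 2
    then have "peak (2 * (n + 1)) v = 2 * N"
      unfolding peak_def N(2) by (simp add: max_def)
    then have "3 * N * (2 * N + 0) \<le> 3 * N * (peak (2 * (n + 1)) v + peak (n + 1) \<psi>)"
      using pk N by (intro mult_left_mono add_mono) auto
    moreover have "2 * N\<^sup>2 \<le> 3 * N * (2 * N + 0)" by (simp add: power2_eq_square)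
    ultimately show ?thesis using trivial by (meson order_trans)
  next
    case 3
    have pos: "0 < 1 / N" "0 < 1 / (2 * N)" using N by simp_all
    then have s: "0 < sin \<psi>" "0 < \<bar>sin v\<bar>" using 3 by linarith+
    define p q where "p = 1 / \<bar>sin v\<bar>" and "q = 1 / sin \<psi>"
    have p: "0 < p" "p \<le> 2 * N" and q: "0 < q" "q \<le> N"
      using s 3 N by (simp_all add: p_def q_def field_simps)
    have peaks: "peak (2 * (n + 1)) v = p" "peak (n + 1) \<psi> = q"
      using 3 s unfolding peak_def N(2) N_def[symmetric] p_def q_def by (simp_all add: max_def)
    have \<psi>': "0 < \<psi>" "\<psi> < pi"
      using s \<psi> by (auto simp: less_le)
    have "sin u > 0" unfolding u_def using \<theta> \<psi> by (intro sin_gt_zero) auto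
    have sumprod: "sin \<theta> + sin \<psi> = 2 * sin u * cos v" "sin \<theta> - sin \<psi> = 2 * sin v * cos u"
      unfolding u_def v_def by (rule sin_plus_sin, rule sin_diff_sin)
    have "sin \<theta> + sin \<psi> \<le> 2 * sin u * 1"
      unfolding sumprod using \<open>sin u > 0\<close> by (intro mult_left_mono) auto
    then have su: "sin \<theta> \<le> 2 * sin u" using s by linarith
    have "\<bar>sin \<theta> - sin \<psi>\<bar> \<le> 2 * \<bar>sin v\<bar> * 1"
      unfolding sumprod abs_mult by (intro mult_mono) auto
    then have sv: "sin \<theta> \<le> sin \<psi> + 2 * \<bar>sin v\<bar>" by linarith
    have pq: "sin \<theta> * (p * q) \<le> p + 2 * q"
    proof -
      have "sin \<theta> * (p * q) \<le> (sin \<psi> + 2 * \<bar>sin v\<bar>) * (p * q)"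
        using sv p q by (intro mult_right_mono) auto
      also have "\<dots> = p + 2 * q" unfolding p_def q_def using s by (simp add: field_simps)
      finally show ?thesis .
    qed
    have su': "sin \<theta> / sin u \<le> 2" using su \<open>sin u > 0\<close> by (simp add: field_simps)
    have "\<bar>sin \<psi> * cheb_kernel n \<theta> (cos \<psi>)\<bar> \<le> N * sin \<theta> / (4 * sin u * \<bar>sin v\<bar>) + 1 / (2 * (sin v)\<^sup>2)"
      using cheb_kernel_le[of \<theta> n \<psi>] \<theta> \<psi>' s unfolding N_def u_def v_def by simp
    also have "\<dots> = N / 4 * p * (sin \<theta> / sin u) + p\<^sup>2 / 2"
      by (simp add: p_def power_divide mult_ac)
    also have "\<dots> \<le> N / 4 * p * 2 + p\<^sup>2 / 2"
      using su' N p by (intro add_right_mono mult_left_mono) auto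
    \<comment> \<open>One factor p of the square is replaced by its cap 2N.\<close>
    also have "\<dots> \<le> N / 4 * p * 2 + N * p"
      using p by (simp add: power2_eq_square)
    finally have "sin \<psi> * \<bar>cheb_kernel n \<theta> (cos \<psi>)\<bar> \<le> 3 / 2 * N * p"
      using s by (simp add: abs_mult)
    then have "sin \<theta> * q * (sin \<psi> * \<bar>cheb_kernel n \<theta> (cos \<psi>)\<bar>) \<le> sin \<theta> * q * (3 / 2 * N * p)"
      using sin\<theta> q by (intro mult_left_mono) auto
    moreover have "sin \<theta> * q * (sin \<psi> * \<bar>cheb_kernel n \<theta> (cos \<psi>)\<bar>) = sin \<theta> * \<bar>cheb_kernel n \<theta> (cos \<psi>)\<bar>"
      unfolding q_def using s by simp
    ultimately have "sin \<theta> * \<bar>cheb_kernel n \<theta> (cos \<psi>)\<bar> \<le> 3 / 2 * N * (sin \<theta> * (p * q))"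
      by (simp only: mult_ac)
    also have "\<dots> \<le> 3 / 2 * N * (p + 2 * q)"
      using pq N by (intro mult_left_mono) auto
    also have "\<dots> \<le> 3 * N * (p + q)"
      using N p by (simp add: algebra_simps)
    finally show ?thesis unfolding peaks .
  qed
  then show ?thesis unfolding v_def .
qed

lemma theta_bounds:
  assumes "j \<in> {1..2 * m}"
  shows "0 < theta m j" "theta m j < pi" "0 < sin (theta m j)"
proof -
  have "real j * pi < real (2 * m + 1) * pi"
    using assms by (intro mult_strict_right_mono) auto
  then show "0 < theta m j" "theta m j < pi"
    using assms by (auto simp: theta_def pos_divide_less_eq mult.commute)
  then show "0 < sin (theta m j)" by (rule sin_gt_zero)
qed

lemma T_fun_eq_cheb_kernel:
  "T_fun m j \<nu> (x, y)
    = cheb_kernel (2 * m) (theta m j) (x * cos (phi m \<nu>) + y * sin (phi m \<nu>)) / (real (2 * m + 1))\<^sup>2"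
  by (simp add: T_fun_def cheb_kernel_def ridge_U_def)

text \<open>The half-chord of the ray \<open>(j, \<nu>)\<close> has length \<open>sin (theta m j)\<close>, so this is the Lebesgue function
  of the operator at \<open>p\<close>, up to the factor \<open>2\<close>.\<close>

definition lebesgue_fun :: "nat \<Rightarrow> real \<times> real \<Rightarrow> real" where
  "lebesgue_fun m p = (\<Sum>\<nu> = 0..2 * m. \<Sum>j = 1..2 * m. sin (theta m j) * \<bar>T_fun m j \<nu> p\<bar>)"

text \<open>The half angles are consecutive points of a grid of step pi / (2N); completing it to 2N
  points covers one period. The second peak does not depend on j and is counted fewer than N
  times.\<close>

lemma sum_T_fun_le:
  assumes "0 \<le> \<psi>" "\<psi> \<le> pi" "x * cos (phi m \<nu>) + y * sin (phi m \<nu>) = cos \<psi>"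
  defines "N \<equiv> 2 * m + 1"
  shows "(\<Sum>j = 1..2 * m. sin (theta m j) * \<bar>T_fun m j \<nu> (x, y)\<bar>) \<le> 12 * harm (2 * N) + 3 * peak N \<psi>"
proof -
  have N: "real N > 0" by (simp add: N_def)
  have "(\<Sum>j = 1..2 * m. sin (theta m j) * \<bar>T_fun m j \<nu> (x, y)\<bar>)
      \<le> (\<Sum>j = 1..2 * m. 3 / N * (peak (2 * N) ((theta m j - \<psi>) / 2) + peak N \<psi>))"
  proof (rule sum_mono)
    fix j assume "j \<in> {1..2 * m}"
    note th = theta_bounds[OF this]
    have "real N * theta m j = real j * pi" by (simp add: N_def theta_def)
    then have "sin (theta m j) * \<bar>cheb_kernel (2 * m) (theta m j) (cos \<psi>)\<bar>
        \<le> 3 * N * (peak (2 * N) ((theta m j - \<psi>) / 2) + peak N \<psi>)"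
      using sin_mult_cheb_kernel_le_peak[of "theta m j" "2 * m" \<psi>] th assms(1,2) unfolding N_def by simp
    from divide_right_mono[OF this zero_le_power2[of "real N"]]
    show "sin (theta m j) * \<bar>T_fun m j \<nu> (x, y)\<bar>
        \<le> 3 / N * (peak (2 * N) ((theta m j - \<psi>) / 2) + peak N \<psi>)"
      unfolding T_fun_eq_cheb_kernel assms(3) N_def[symmetric] using N by (simp add: power2_eq_square)
  qed
  also have "\<dots> = 3 / N * ((\<Sum>j = 1..2 * m. peak (2 * N) ((theta m j - \<psi>) / 2)) + 2 * m * peak N \<psi>)"
    by (simp only: sum_distrib_left[symmetric] sum.distrib sum_constant card_atLeastAtMost) simp
  also have "\<dots> \<le> 3 / N * (4 * N * harm (2 * N) + N * peak N \<psi>)"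
  proof (intro mult_left_mono add_mono mult_right_mono)
    have "(\<Sum>j = 1..2 * m. peak (2 * N) ((theta m j - \<psi>) / 2))
        = (\<Sum>j = 1..2 * m. peak (2 * N) (- \<psi> / 2 + real j * pi / real (2 * N)))"
      by (intro sum.cong refl arg_cong2[of _ _ _ _ peak]) (simp add: theta_def N_def diff_divide_distrib)
    also have "\<dots> \<le> (\<Sum>j<2 * N. peak (2 * N) (- \<psi> / 2 + real j * pi / real (2 * N)))"
      by (intro sum_mono2) (auto simp: N_def peak_nonneg)
    also have "\<dots> \<le> 2 * real (2 * N) * harm (2 * N)"
      by (intro sum_peak_le) (simp add: N_def)
    finally show "(\<Sum>j = 1..2 * m. peak (2 * N) ((theta m j - \<psi>) / 2)) \<le> 4 * N * harm (2 * N)"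
      by simp
  qed (auto simp: N_def peak_nonneg)
  also have "\<dots> = 12 * harm (2 * N) + 3 * peak N \<psi>"
    using N by (simp add: field_simps)
  finally show ?thesis .
qed

text \<open>The angles \<open>phi m \<nu>\<close> are the even multiples of pi / N below 2 pi.
  Adding the odd ones leaves a grid of step pi / N over two periods of \<open>peak\<close>.\<close>

lemma sum_peak_phi_le:
  fixes m :: nat
  defines "N \<equiv> 2 * m + 1"
  shows "(\<Sum>\<nu> = 0..2 * m. peak N (phi m \<nu> - \<beta>)) \<le> 4 * N * harm N"
proof -
  let ?h = "\<lambda>i. peak N (- \<beta> + real i * pi / N)"
  have "(\<Sum>\<nu> = 0..2 * m. peak N (phi m \<nu> - \<beta>)) = (\<Sum>\<nu> = 0..2 * m. ?h (2 * \<nu>))"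
    by (intro sum.cong refl arg_cong2[of _ _ _ _ peak]) (simp add: phi_def N_def)
  also have "\<dots> = sum ?h ((*) 2 ` {0..2 * m})"
    by (subst sum.reindex) (auto simp: inj_on_def)
  also have "\<dots> \<le> sum ?h {..<2 * N}"
    by (intro sum_mono2) (auto simp: N_def peak_nonneg)
  also have "\<dots> = sum ?h {..<N} + (\<Sum>i<N. ?h (N + i))"
  proof -
    have "sum ?h {..<N + k} = sum ?h {..<N} + (\<Sum>i<k. ?h (N + i))" for k
      by (induction k) simp_all
    then show ?thesis unfolding mult_2 .
  qed
  also have "(\<Sum>i<N. ?h (N + i)) = sum ?h {..<N}"
  proof (intro sum.cong refl)
    fix i
    have "- \<beta> + real (N + i) * pi / N = (- \<beta> + real i * pi / N) + pi"
      by (simp add: N_def field_simps)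
    then show "?h (N + i) = ?h i" by (simp only: peak_add_pi)
  qed
  also have "sum ?h {..<N} + sum ?h {..<N} \<le> 4 * N * harm N"
  proof -
    have "N > 0" by (simp add: N_def)
    from sum_peak_le[OF this, of "- \<beta>"] show ?thesis by linarith
  qed
  finally show ?thesis by simp
qed

lemma lebesgue_fun_le:
  assumes "p \<in> B2"
  shows "lebesgue_fun m p \<le> 24 * real (2 * m + 1) * harm (2 * (2 * m + 1))"
proof -
  define N where "N = 2 * m + 1"
  obtain x y where p: "p = (x, y)" by fastforce
  with assms have xy: "x\<^sup>2 + y\<^sup>2 \<le> 1" by (simp add: B2_def)
  obtain r \<beta> where \<beta>: "x = r * cos \<beta>" "y = r * sin \<beta>"
    using polar_Ex[of x y] by blast
  have "x\<^sup>2 + y\<^sup>2 = r\<^sup>2 * ((sin \<beta>)\<^sup>2 + (cos \<beta>)\<^sup>2)"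
    unfolding \<beta> by algebra
  with xy have r: "\<bar>r\<bar> \<le> 1" by (simp add: abs_square_le_1)
  have row: "(\<Sum>j = 1..2 * m. sin (theta m j) * \<bar>T_fun m j \<nu> (x, y)\<bar>)
      \<le> 12 * harm (2 * N) + 3 * peak N (phi m \<nu> - \<beta>)" for \<nu>
  proof -
    \<comment> \<open>c is the argument of the ridge polynomial in polar coordinates. Shrinking the
      cosine by r only enlarges the sine, so the peak at \<open>\<psi>\<close> is dominated by the
      one at \<open>phi m \<nu> - \<beta>\<close>.\<close>
    define c where "c = r * cos (phi m \<nu> - \<beta>)"
    have "\<bar>c\<bar> \<le> 1 * \<bar>cos (phi m \<nu> - \<beta>)\<bar>"
      unfolding c_def abs_mult using r by (intro mult_right_mono) auto
    then have c: "\<bar>c\<bar> \<le> \<bar>cos (phi m \<nu> - \<beta>)\<bar>" "\<bar>c\<bar> \<le> 1"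
      using abs_cos_le_one[of "phi m \<nu> - \<beta>"] by linarith+
    define \<psi> where "\<psi> = arccos c"
    have \<psi>: "0 \<le> \<psi>" "\<psi> \<le> pi" "cos \<psi> = c"
      using c(2) by (auto simp: \<psi>_def abs_le_iff arccos_lbound arccos_ubound cos_arccos)
    have "x * cos (phi m \<nu>) + y * sin (phi m \<nu>) = cos \<psi>"
      unfolding \<psi> c_def \<beta> by (simp add: cos_diff algebra_simps)
    then have "(\<Sum>j = 1..2 * m. sin (theta m j) * \<bar>T_fun m j \<nu> (x, y)\<bar>)
        \<le> 12 * harm (2 * N) + 3 * peak N \<psi>"
      unfolding N_def by (intro sum_T_fun_le \<psi>)
    moreover have "peak N \<psi> \<le> peak N (phi m \<nu> - \<beta>)"
    proof (rule peak_antimono)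
      have "(cos \<psi>)\<^sup>2 \<le> (cos (phi m \<nu> - \<beta>))\<^sup>2"
        unfolding \<psi> using c(1) by (simp add: abs_le_square_iff)
      then show "\<bar>sin (phi m \<nu> - \<beta>)\<bar> \<le> \<bar>sin \<psi>\<bar>"
        unfolding abs_le_square_iff sin_squared_eq by simp
    qed (simp add: N_def)
    ultimately show ?thesis by linarith
  qed
  have "lebesgue_fun m p \<le> (\<Sum>\<nu> = 0..2 * m. 12 * harm (2 * N) + 3 * peak N (phi m \<nu> - \<beta>))"
    unfolding lebesgue_fun_def p by (intro sum_mono row)
  also have "\<dots> = 12 * N * harm (2 * N) + 3 * (\<Sum>\<nu> = 0..2 * m. peak N (phi m \<nu> - \<beta>))"
    by (simp add: sum.distrib sum_distrib_left N_def)
  also have "\<dots> \<le> 12 * N * harm (2 * N) + 3 * (4 * N * harm N)"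
    using sum_peak_phi_le[of m \<beta>] by (simp add: N_def)
  also have "\<dots> \<le> 12 * N * harm (2 * N) + 3 * (4 * N * harm (2 * N))"
    by (intro add_left_mono mult_left_mono harm_mono) auto
  finally show ?thesis by (simp add: N_def algebra_simps)
qed

section \<open>Lower bound at the origin\<close>

text \<open>At \<open>\<psi> = pi / 2\<close> with N odd, \<open>cos (N * \<psi>)\<close> is 0 and
  \<open>sin (N * \<psi>)\<close> is 1 or -1. Twice the kernel is then N \<open>tan \<theta>\<close>
  up to sign, minus \<open>sin \<theta> / (cos \<theta>)\<^sup>2\<close>. The hypothesis on
  \<open>N * cos \<theta>\<close> makes the second term at most two thirds of the first, so a third
  survives.\<close>

lemma abs_cheb_kernel_zero_ge:
  fixes m :: nat and \<theta> :: real
  defines "N \<equiv> real (2 * m + 1)"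
  assumes \<theta>: "0 < \<theta>" "\<theta> < pi" "sin (N * \<theta>) = 0" and c: "3 / 2 \<le> N * cos \<theta>"
  shows "N * sin \<theta> / (6 * cos \<theta>) \<le> \<bar>cheb_kernel (2 * m) \<theta> 0\<bar>"
proof -
  define u v where "u = (\<theta> + pi / 2) / 2" and "v = (\<theta> - pi / 2) / 2"
  have N: "N > 0" by (simp add: N_def)
  have "0 < N * cos \<theta>" using c by linarith
  with N have cos: "cos \<theta> > 0" by (simp add: zero_less_mult_iff)
  have sin: "sin \<theta> > 0" using \<theta> by (intro sin_gt_zero)
  have uv: "u + v = \<theta>" "u - v = pi / 2" by (simp_all add: u_def v_def field_simps)
  have prod: "sin u * sin v = - cos \<theta> / 2"
    using cos_diff[of u v] cos_add[of u v] unfolding uv by simp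
  with cos have ne: "sin u \<noteq> 0" "sin v \<noteq> 0" by auto
  have "1 / (sin v)\<^sup>2 - 1 / (sin u)\<^sup>2 = ((sin u)\<^sup>2 - (sin v)\<^sup>2) / (sin u * sin v)\<^sup>2"
    using ne by (simp add: field_simps)
  also have "(sin u)\<^sup>2 - (sin v)\<^sup>2 = sin \<theta>"
    unfolding sin_squared_diff uv by simp
  finally have d: "1 / (sin v)\<^sup>2 - 1 / (sin u)\<^sup>2 = 4 * (sin \<theta> / (cos \<theta>)\<^sup>2)"
    unfolding prod by (simp add: power_divide)
  have c0: "cos (N * (pi / 2)) = 0"
    unfolding cos_zero_iff_int N_def by (intro exI[of _ "2 * int m + 1"]) simp
  then have C: "cos (N * \<theta>) * cos (N * (pi / 2)) = 0" by simp
  have S': "\<bar>sin (N * (pi / 2))\<bar> = 1"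
    using sin_cos_squared_add[of "N * (pi / 2)"] unfolding c0 by (auto simp: power2_eq_1_iff)
  define S where "S = cos (N * \<theta>) * sin (N * (pi / 2))"
  have S: "\<bar>S\<bar> = 1"
    unfolding S_def abs_mult S' using sin_zero_abs_cos_one[OF \<theta>(3)] by simp
  have "2 * cheb_kernel (2 * m) \<theta> 0
      = - (N / 2 * S * (sin \<theta> / (- cos \<theta> / 2))) - 1 / 4 * (4 * (sin \<theta> / (cos \<theta>)\<^sup>2))"
    using sin_mult_cheb_kernel_closed[of "2 * m" \<theta> "pi / 2", folded N_def u_def v_def, OF \<theta>(3) ne,
      unfolded C d prod, folded S_def] by simp
  also have "\<dots> = S * (N * sin \<theta> / cos \<theta>) - sin \<theta> / (cos \<theta>)\<^sup>2"
    by simp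
  finally have "2 * \<bar>cheb_kernel (2 * m) \<theta> 0\<bar> = \<bar>S * (N * sin \<theta> / cos \<theta>) - sin \<theta> / (cos \<theta>)\<^sup>2\<bar>"
    by (simp add: abs_mult[symmetric])
  moreover have "\<bar>S * (N * sin \<theta> / cos \<theta>)\<bar> = N * sin \<theta> / cos \<theta>"
    unfolding abs_mult S using N sin cos by simp
  moreover have "\<bar>sin \<theta> / (cos \<theta>)\<^sup>2\<bar> \<le> 2 / 3 * (N * sin \<theta> / cos \<theta>)"
    using sin cos c by (simp add: field_simps power2_eq_square)
  ultimately have "1 / 3 * (N * sin \<theta> / cos \<theta>) \<le> 2 * \<bar>cheb_kernel (2 * m) \<theta> 0\<bar>"
    by linarith
  then show ?thesis by simp
qed

lemma sum_abs_cheb_kernel_zero_ge: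
  fixes m :: nat
  defines "N \<equiv> real (2 * m + 1)"
  assumes "m > 0"
  shows "N\<^sup>2 / (24 * pi) * ln (real m + 1) \<le> (\<Sum>j = 1..2 * m. sin (theta m j) * \<bar>cheb_kernel (2 * m) (theta m j) 0\<bar>)"
proof -
  let ?t = "\<lambda>j. sin (theta m j) * \<bar>cheb_kernel (2 * m) (theta m j) 0\<bar>"
  \<comment> \<open>Only the q nodes j = m - i just below pi/2 are used; q is m/2 rounded up, which
    keeps them within pi/4 of pi/2 and still gives (q + 1)^2 at least m + 1.\<close>
  define q where "q = (m + 1) div 2"
  have q: "q \<le> m" "2 * q \<le> m + 1" "m \<le> 2 * q" unfolding q_def using assms by linarith+
  have N: "N \<ge> 3" using assms by (simp add: N_def)
  have summand: "N\<^sup>2 / (12 * pi) * inverse (real (Suc i)) \<le> ?t (m - i)" if "i < q" for i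
  proof -
    define \<eta> where "\<eta> = real (2 * i + 1) * pi / (2 * N)"
    have \<eta>: "theta m (m - i) = pi / 2 - \<eta>"
      using that q N unfolding theta_def \<eta>_def N_def[symmetric]
      by (simp add: of_nat_diff field_simps N_def)
    have sc: "sin (theta m (m - i)) = cos \<eta>" "cos (theta m (m - i)) = sin \<eta>"
      unfolding \<eta> by (simp_all add: sin_diff cos_diff)
    have "m - i \<in> {1..2 * m}" using that q by auto
    note th = theta_bounds[OF this]
    have "real (2 * i + 1) \<le> N / 2" using that q by (simp add: N_def field_simps)
    then have "\<eta> \<le> N / 2 * pi / (2 * N)" unfolding \<eta>_def using N by (intro divide_right_mono mult_right_mono) auto
    also have "\<dots> = pi / 4" using N by simp
    finally have \<eta>4: "\<eta> \<le> pi / 4" .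
    have "pi / (2 * N) \<le> \<eta>" unfolding \<eta>_def using N by (intro divide_right_mono) auto
    moreover have \<eta>0: "0 < \<eta>" unfolding \<eta>_def using N by simp
    \<comment> \<open>Since N is at least 3, concavity compares pi / (2N) with pi/6. This is the
      source of the constant 3/2, attained at N = 3.\<close>
    moreover have "3 / N * sin (pi / 6) \<le> sin (3 / N * (pi / 6))"
      using N by (intro sin_scale_ge) (auto simp: field_simps)
    moreover have "sin (pi / (2 * N)) \<le> sin \<eta>"
    proof (rule sin_monotone_2pi_le)
      have "0 \<le> pi / (2 * N)" using N by simp
      then show "- (pi / 2) \<le> pi / (2 * N)" using pi_ge_zero by linarith
      show "\<eta> \<le> pi / 2" using \<eta>4 pi_ge_zero by linarith
    qed fact
    ultimately have "3 / (2 * N) \<le> sin \<eta>" by (simp add: sin_30 mult.commute)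
    then have big: "3 / 2 \<le> N * cos (theta m (m - i))" unfolding sc using N by (simp add: field_simps)
    have sin: "0 < sin \<eta>" "sin \<eta> \<le> \<eta>"
      using \<eta>0 \<eta>4 by (auto intro!: sin_gt_zero sin_x_le_x)
    have "cos (pi / 4) \<le> cos \<eta>"
      using \<eta>0 \<eta>4 by (intro cos_monotone_0_pi_le) auto
    then have "(cos (pi / 4))\<^sup>2 \<le> (cos \<eta>)\<^sup>2" by (intro power_mono) (auto simp: cos_45)
    then have cos2: "1 / 2 \<le> (cos \<eta>)\<^sup>2" by (simp add: cos_45 power_divide)
    have "N * theta m (m - i) = real (m - i) * pi" using N by (simp add: theta_def N_def)
    then have "N * sin (theta m (m - i)) / (6 * cos (theta m (m - i))) \<le> \<bar>cheb_kernel (2 * m) (theta m (m - i)) 0\<bar>"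
      using abs_cheb_kernel_zero_ge[of "theta m (m - i)" m] th big unfolding N_def by simp
    then have "cos \<eta> * (N * cos \<eta> / (6 * sin \<eta>)) \<le> ?t (m - i)"
      using th(3) unfolding sc by (intro mult_left_mono) auto
    moreover have "cos \<eta> * (N * cos \<eta> / (6 * sin \<eta>)) = N / 6 * ((cos \<eta>)\<^sup>2 / sin \<eta>)"
      by (simp add: power2_eq_square)
    moreover have "N / 6 * ((1 / 2) / \<eta>) \<le> N / 6 * ((cos \<eta>)\<^sup>2 / sin \<eta>)"
      using N cos2 sin by (intro mult_left_mono frac_le) auto
    moreover have "N\<^sup>2 / (12 * pi) * inverse (real (Suc i)) \<le> N / 6 * ((1 / 2) / \<eta>)"
    proof -
      have "N / 6 * ((1 / 2) / \<eta>) = N\<^sup>2 / (12 * pi) * (2 * inverse (real (2 * i + 1)))"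
        unfolding \<eta>_def using N by (simp add: field_simps power2_eq_square)
      moreover have "inverse (real (Suc i)) \<le> 2 * inverse (real (2 * i + 1))"
        by (simp add: field_simps)
      ultimately show ?thesis by (simp only: mult_left_mono zero_le_power2 divide_nonneg_nonneg pi_ge_zero mult_nonneg_nonneg zero_le_numeral)
    qed
    ultimately show ?thesis by linarith
  qed
  have "(real m + 1) \<le> (real q + 1)\<^sup>2"
  proof -
    have "real m \<le> 2 * real q" using q by linarith
    then show ?thesis unfolding power2_sum by (simp add: add_increasing)
  qed
  then have "ln (real m + 1) \<le> ln ((real q + 1)\<^sup>2)" by simp
  also have "\<dots> = 2 * ln (real q + 1)" by (simp add: ln_realpow)
  also have "\<dots> \<le> 2 * harm q" using ln_le_harm[of q] by simp
  finally have "N\<^sup>2 / (24 * pi) * ln (real m + 1) \<le> N\<^sup>2 / (24 * pi) * (2 * harm q)"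
    by (intro mult_left_mono) auto
  also have "\<dots> = (\<Sum>i<q. N\<^sup>2 / (12 * pi) * inverse (real (Suc i)))"
    unfolding harm_altdef sum_distrib_left by (intro sum.cong refl) (simp add: mult_ac)
  also have "\<dots> \<le> (\<Sum>i<q. ?t (m - i))"
    by (intro sum_mono summand) auto
  also have "\<dots> = sum ?t ((\<lambda>i. m - i) ` {..<q})"
    using q by (subst sum.reindex) (auto simp: inj_on_def)
  also have "\<dots> \<le> sum ?t {1..2 * m}"
  proof (rule sum_mono2)
    show "(\<lambda>i. m - i) ` {..<q} \<subseteq> {1..2 * m}" using q by auto
    fix j assume "j \<in> {1..2 * m} - (\<lambda>i. m - i) ` {..<q}"
    then have "j \<in> {1..2 * m}" by blast
    from theta_bounds(3)[OF this] show "0 \<le> ?t j" by simp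
  qed simp
  finally show ?thesis .
qed

lemma lebesgue_fun_origin_ge:
  assumes "m > 0"
  shows "real (2 * m + 1) / (24 * pi) * ln (real m + 1) \<le> lebesgue_fun m (0, 0)"
proof -
  define N where "N = real (2 * m + 1)"
  have N: "N > 0" by (simp add: N_def)
  let ?K = "\<Sum>j = 1..2 * m. sin (theta m j) * \<bar>cheb_kernel (2 * m) (theta m j) 0\<bar>"
  have "N / (24 * pi) * ln (real m + 1) = (N\<^sup>2 / (24 * pi) * ln (real m + 1)) / N"
    using N by (simp add: power2_eq_square)
  also have "\<dots> \<le> ?K / N"
    unfolding N_def using assms by (intro divide_right_mono sum_abs_cheb_kernel_zero_ge) auto
  \<comment> \<open>At the origin every ridge polynomial is evaluated at 0, so the N directions
    contribute equally.\<close>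
  also have "\<dots> = N * (?K / N\<^sup>2)"
    using N by (simp add: power2_eq_square)
  also have "\<dots> = lebesgue_fun m (0, 0)"
    unfolding lebesgue_fun_def T_fun_eq_cheb_kernel N_def[symmetric]
    by (simp add: sum_divide_distrib N_def)
  finally show ?thesis unfolding N_def .
qed

section \<open>The operator norm\<close>

definition ray :: "real \<Rightarrow> real \<Rightarrow> real \<Rightarrow> real \<times> real" where
  "ray \<phi> t s = (t * cos \<phi> - s * sin \<phi>, t * sin \<phi> + s * cos \<phi>)"

lemma ray_in_B2:
  assumes "\<bar>s\<bar> \<le> sin \<theta>"
  shows "ray \<phi> (cos \<theta>) s \<in> B2"
proof -
  have "(cos \<theta> * cos \<phi> - s * sin \<phi>)\<^sup>2 + (cos \<theta> * sin \<phi> + s * cos \<phi>)\<^sup>2 = (cos \<theta>)\<^sup>2 + s\<^sup>2"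
    using sin_cos_squared_add[of \<phi>] by algebra
  moreover have "s\<^sup>2 \<le> (sin \<theta>)\<^sup>2" using assms by (simp add: abs_le_square_iff[symmetric])
  ultimately show ?thesis
    unfolding ray_def B2_def sin_squared_eq by simp
qed

lemma continuous_on_ray: "continuous_on S (ray \<phi> t)"
  unfolding ray_def by (intro continuous_intros)

lemma radon_cos:
  assumes "0 \<le> sin \<theta>"
  shows "radon \<phi> f (cos \<theta>) = integral {- sin \<theta>..sin \<theta>} (\<lambda>s. f (ray \<phi> (cos \<theta>) s))"
  using assms unfolding radon_def ray_def by (simp add: sin_squared_eq[symmetric])

lemma unif_norm_le_iff: "unif_norm f \<le> ereal c \<longleftrightarrow> (\<forall>p\<in>B2. \<bar>f p\<bar> \<le> c)"
  unfolding unif_norm_def SUP_le_iff by simp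

lemma abs_radon_cos_le:
  assumes f: "f \<in> C_B2" "unif_norm f \<le> 1" and \<theta>: "0 \<le> sin \<theta>"
  shows "\<bar>radon \<phi> f (cos \<theta>)\<bar> \<le> 2 * sin \<theta>"
proof -
  have img: "ray \<phi> (cos \<theta>) ` {- sin \<theta>..sin \<theta>} \<subseteq> B2"
    by (auto intro!: ray_in_B2)
  have "norm (integral {- sin \<theta>..sin \<theta>} (\<lambda>s. f (ray \<phi> (cos \<theta>) s))) \<le> 1 * (sin \<theta> - - sin \<theta>)"
  proof (rule integral_bound)
    show "continuous_on {- sin \<theta>..sin \<theta>} (\<lambda>s. f (ray \<phi> (cos \<theta>) s))"
      using f(1) img by (intro continuous_on_compose2[OF _ continuous_on_ray]) (auto simp: C_B2_def)
    show "norm (f (ray \<phi> (cos \<theta>) s)) \<le> 1" if "s \<in> {- sin \<theta>..sin \<theta>}" for s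
    proof -
      have "ray \<phi> (cos \<theta>) s \<in> B2" using img that by blast
      with f(2) show ?thesis unfolding one_ereal_def unif_norm_le_iff by simp
    qed
  qed (use \<theta> in auto)
  then show ?thesis unfolding radon_cos[OF \<theta>] by simp
qed

lemma op_norm_A_op_le:
  assumes "\<And>p. p \<in> B2 \<Longrightarrow> 2 * lebesgue_fun m p \<le> c"
  shows "op_norm (A_op m) \<le> ereal c"
  unfolding op_norm_def
proof (rule SUP_least)
  fix f assume "f \<in> {f \<in> C_B2. unif_norm f \<le> 1}"
  then have f: "f \<in> C_B2" "unif_norm f \<le> 1" by auto
  show "unif_norm (A_op m f) \<le> ereal c"
    unfolding unif_norm_le_iff
  proof
    fix p assume p: "p \<in> B2"
    have "\<bar>A_op m f p\<bar> \<le> (\<Sum>\<nu> = 0..2 * m. \<Sum>j = 1..2 * m. \<bar>radon (phi m \<nu>) f (cos (theta m j)) * T_fun m j \<nu> p\<bar>)"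
      unfolding A_op_def by (intro order_trans[OF sum_abs] sum_mono sum_abs)
    also have "\<dots> \<le> (\<Sum>\<nu> = 0..2 * m. \<Sum>j = 1..2 * m. 2 * (sin (theta m j) * \<bar>T_fun m j \<nu> p\<bar>))"
    proof (intro sum_mono)
      fix \<nu> j assume "j \<in> {1..2 * m}"
      then have "\<bar>radon (phi m \<nu>) f (cos (theta m j))\<bar> \<le> 2 * sin (theta m j)"
        using f theta_bounds(3) by (intro abs_radon_cos_le) (auto intro: less_imp_le)
      then have "\<bar>radon (phi m \<nu>) f (cos (theta m j))\<bar> * \<bar>T_fun m j \<nu> p\<bar> \<le> 2 * sin (theta m j) * \<bar>T_fun m j \<nu> p\<bar>"
        by (intro mult_right_mono) auto
      then show "\<bar>radon (phi m \<nu>) f (cos (theta m j)) * T_fun m j \<nu> p\<bar> \<le> 2 * (sin (theta m j) * \<bar>T_fun m j \<nu> p\<bar>)"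
        by (simp add: abs_mult)
    qed
    also have "\<dots> = 2 * lebesgue_fun m p"
      unfolding lebesgue_fun_def sum_distrib_left ..
    also have "\<dots> \<le> c" by (rule assms[OF p])
    finally show "\<bar>A_op m f p\<bar> \<le> c" .
  qed
qed

lemma abs_A_op_le_op_norm:
  assumes "f \<in> C_B2" "unif_norm f \<le> 1" "p \<in> B2"
  shows "ereal \<bar>A_op m f p\<bar> \<le> op_norm (A_op m)"
proof -
  have "ereal \<bar>A_op m f p\<bar> \<le> unif_norm (A_op m f)"
    unfolding unif_norm_def using assms by (intro SUP_upper)
  also have "\<dots> \<le> op_norm (A_op m)"
    unfolding op_norm_def using assms by (intro SUP_upper) auto
  finally show ?thesis .
qed

section \<open>Intersections of the rays\<close>

lemma sin_phi_diff_eq_0: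
  assumes "sin (phi m \<mu> - phi m \<nu>) = 0" "\<mu> \<le> 2 * m" "\<nu> \<le> 2 * m"
  shows "\<mu> = \<nu>"
proof -
  obtain i :: int where "phi m \<mu> - phi m \<nu> = of_int i * pi"
    using assms(1) unfolding sin_zero_iff_int2 by blast
  moreover have "phi m \<mu> - phi m \<nu> = 2 * (real \<mu> - real \<nu>) * pi / real (2 * m + 1)"
    by (simp add: phi_def diff_divide_distrib right_diff_distrib left_diff_distrib mult_ac)
  ultimately have "2 * (real \<mu> - real \<nu>) * pi = (real_of_int i * real (2 * m + 1)) * pi"
    by (simp add: nonzero_divide_eq_eq mult_ac)
  then have "2 * (real \<mu> - real \<nu>) = real_of_int i * real (2 * m + 1)"
    unfolding mult_cancel_right by simp
  then have "real_of_int (2 * (int \<mu> - int \<nu>)) = real_of_int (i * int (2 * m + 1))" by simp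
  then have eq: "2 * (int \<mu> - int \<nu>) = i * int (2 * m + 1)" unfolding of_int_eq_iff .
  \<comment> \<open>Because 2m + 1 is odd, i is even and 2m + 1 divides the index difference, which
    is too small to be a nonzero multiple. Hence different directions are never parallel.\<close>
  then have "even (i * int (2 * m + 1))" by (metis dvd_triv_left)
  then obtain k where "i = 2 * k" by (auto elim: evenE)
  with eq have "int \<mu> - int \<nu> = k * int (2 * m + 1)" by simp
  then have "int (2 * m + 1) dvd int \<mu> - int \<nu>" by simp
  moreover have "\<bar>int \<mu> - int \<nu>\<bar> < int (2 * m + 1)" using assms by linarith
  ultimately have "int \<mu> - int \<nu> = 0" by (metis dvd_imp_le_int abs_of_nat not_le)
  then show ?thesis by simp
qed

lemma cos_theta_inj:
  assumes "cos (theta m i) = cos (theta m j)" "i \<in> {1..2 * m}" "j \<in> {1..2 * m}"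
  shows "i = j"
proof -
  have "theta m i = theta m j"
    by (rule cos_inj_pi) (use theta_bounds(1,2)[OF assms(2)] theta_bounds(1,2)[OF assms(3)] assms(1)
      in \<open>simp_all only: less_imp_le\<close>)
  then show ?thesis by (simp add: theta_def)
qed

definition line_dist :: "nat \<Rightarrow> nat \<Rightarrow> nat \<Rightarrow> real \<times> real \<Rightarrow> real" where
  "line_dist m \<nu> j = (\<lambda>(x, y). \<bar>x * cos (phi m \<nu>) + y * sin (phi m \<nu>) - cos (theta m j)\<bar>)"

lemma line_dist_ray:
  "line_dist m \<mu> i (ray (phi m \<nu>) t s)
    = \<bar>t * cos (phi m \<mu> - phi m \<nu>) + s * sin (phi m \<mu> - phi m \<nu>) - cos (theta m i)\<bar>"
  unfolding line_dist_def ray_def by (simp add: cos_diff sin_diff algebra_simps)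

text \<open>Along a ray, the signed distance to another line is affine in s: a nonzero constant for
  parallel lines, and of nonzero slope otherwise.\<close>

lemma finite_ray_intersections:
  assumes "\<mu> \<le> 2 * m" "\<nu> \<le> 2 * m" "i \<in> {1..2 * m}" "j \<in> {1..2 * m}" "(\<mu>, i) \<noteq> (\<nu>, j)"
  shows "finite {s. line_dist m \<mu> i (ray (phi m \<nu>) (cos (theta m j)) s) = 0}"
proof (cases "\<mu> = \<nu>")
  case True
  then show ?thesis
    using cos_theta_inj[of m j i] assms unfolding line_dist_ray by auto
next
  case False
  let ?\<delta> = "phi m \<mu> - phi m \<nu>"
  have "sin ?\<delta> \<noteq> 0" using sin_phi_diff_eq_0 assms False by blast
  then have "{s. line_dist m \<mu> i (ray (phi m \<nu>) (cos (theta m j)) s) = 0}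
      \<subseteq> {(cos (theta m i) - cos (theta m j) * cos ?\<delta>) / sin ?\<delta>}"
    unfolding line_dist_ray by (auto simp: field_simps)
  then show ?thesis by (rule finite_subset) simp
qed

section \<open>Continuous functions with prescribed signs on the rays\<close>

definition clip :: "real \<Rightarrow> real" where
  "clip r = max (- 1) (min 1 r)"

lemma abs_clip_le: "\<bar>clip r\<bar> \<le> 1"
  unfolding clip_def by auto

lemma clip_id: "\<bar>r\<bar> \<le> 1 \<Longrightarrow> clip r = r"
  unfolding clip_def by auto

lemma continuous_on_clip: "continuous_on S g \<Longrightarrow> continuous_on S (\<lambda>x. clip (g x))"
  unfolding clip_def by (intro continuous_intros)

lemma tendsto_clip: "(g \<longlongrightarrow> l) F \<Longrightarrow> ((\<lambda>x. clip (g x)) \<longlongrightarrow> clip l) F"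
  unfolding clip_def by (intro tendsto_intros)

text \<open>Around each line stands a ridge of half-width 1/n whose height is the prescribed value.
  Where ridges overlap the sum may leave [-1, 1], so \<open>clip\<close> restores the norm bound
  without losing continuity.\<close>

definition tents :: "nat \<Rightarrow> (nat \<Rightarrow> nat \<Rightarrow> real) \<Rightarrow> nat \<Rightarrow> real \<times> real \<Rightarrow> real" where
  "tents m \<epsilon> n p = clip (\<Sum>\<mu> = 0..2 * m. \<Sum>i = 1..2 * m. \<epsilon> \<mu> i * max 0 (1 - real n * line_dist m \<mu> i p))"

definition tents_limit :: "nat \<Rightarrow> (nat \<Rightarrow> nat \<Rightarrow> real) \<Rightarrow> real \<times> real \<Rightarrow> real" where
  "tents_limit m \<epsilon> p = clip (\<Sum>\<mu> = 0..2 * m. \<Sum>i = 1..2 * m. \<epsilon> \<mu> i * of_bool (line_dist m \<mu> i p = 0))"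

lemma continuous_on_tents: "continuous_on S (tents m \<epsilon> n)"
  unfolding tents_def line_dist_def case_prod_beta
  by (intro continuous_on_clip continuous_intros)

lemma tents_tendsto: "(\<lambda>n. tents m \<epsilon> n p) \<longlonglongrightarrow> tents_limit m \<epsilon> p"
  unfolding tents_def tents_limit_def
proof (intro tendsto_clip tendsto_sum tendsto_mult tendsto_const)
  fix \<mu> i
  show "(\<lambda>n. max 0 (1 - real n * line_dist m \<mu> i p)) \<longlonglongrightarrow> of_bool (line_dist m \<mu> i p = 0)"
  proof (cases "line_dist m \<mu> i p = 0")
    case False
    then have pos: "line_dist m \<mu> i p > 0"
      by (cases p) (auto simp: line_dist_def)
    have "eventually (\<lambda>n. n \<ge> nat \<lceil>1 / line_dist m \<mu> i p\<rceil>) sequentially"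
      by (rule eventually_ge_at_top)
    then have "eventually (\<lambda>n. max 0 (1 - real n * line_dist m \<mu> i p) = 0) sequentially"
    proof eventually_elim
      case (elim n)
      then have "1 / line_dist m \<mu> i p \<le> real n" by linarith
      with pos show ?case by (simp add: field_simps)
    qed
    then show ?thesis using False by (simp add: tendsto_eventually)
  qed simp
qed

text \<open>Dominated convergence with majorant 1 passes to the pointwise limit. On the chord this
  limit is the prescribed value except at the finitely many crossings with other lines, and the
  chord has length \<open>2 * sin (theta m j)\<close>.\<close>

lemma radon_tents_limit:
  assumes \<nu>: "\<nu> \<le> 2 * m" and j: "j \<in> {1..2 * m}" and \<epsilon>: "\<bar>\<epsilon> \<nu> j\<bar> \<le> 1"
  shows "(\<lambda>n. radon (phi m \<nu>) (tents m \<epsilon> n) (cos (theta m j))) \<longlonglongrightarrow> 2 * sin (theta m j) * \<epsilon> \<nu> j"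
proof -
  define I where "I = {0..2 * m} \<times> {1..2 * m}"
  define r where "r = ray (phi m \<nu>) (cos (theta m j))"
  let ?S = "{- sin (theta m j)..sin (theta m j)}"
  have sin: "0 \<le> sin (theta m j)" using theta_bounds(3)[OF j] by simp
  have "(\<lambda>n. integral ?S (\<lambda>s. tents m \<epsilon> n (r s))) \<longlonglongrightarrow> integral ?S (\<lambda>s. tents_limit m \<epsilon> (r s))"
  proof (rule dominated_convergence(2)[where h = "\<lambda>_. 1"])
    show "(\<lambda>s. tents m \<epsilon> n (r s)) integrable_on ?S" for n
      unfolding r_def
      by (intro integrable_continuous_interval continuous_on_compose2[OF continuous_on_tents continuous_on_ray]) auto
    show "norm (tents m \<epsilon> n (r s)) \<le> 1" for n s
      unfolding tents_def real_norm_def by (rule abs_clip_le)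
    show "(\<lambda>n. tents m \<epsilon> n (r s)) \<longlonglongrightarrow> tents_limit m \<epsilon> (r s)" for s
      by (rule tents_tendsto)
  qed (rule integrable_const_ivl)
  moreover have "integral ?S (\<lambda>s. tents_limit m \<epsilon> (r s)) = integral ?S (\<lambda>s. \<epsilon> \<nu> j)"
  proof (rule integral_spike)
    let ?E = "\<Union>(\<mu>, i)\<in>I - {(\<nu>, j)}. {s. line_dist m \<mu> i (r s) = 0}"
    have "finite ?E"
      unfolding r_def by (intro finite_UN_I) (auto simp: I_def intro!: finite_ray_intersections \<nu> j)
    then show "negligible ?E" by (rule negligible_finite)
    fix s assume s: "s \<in> ?S - ?E"
    have "(\<Sum>\<mu> = 0..2 * m. \<Sum>i = 1..2 * m. \<epsilon> \<mu> i * of_bool (line_dist m \<mu> i (r s) = 0))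
        = (\<Sum>(\<mu>, i)\<in>I. \<epsilon> \<mu> i * of_bool (line_dist m \<mu> i (r s) = 0))"
      unfolding I_def by (rule sum.cartesian_product)
    also have "\<dots> = (\<Sum>(\<mu>, i)\<in>{(\<nu>, j)}. \<epsilon> \<mu> i * of_bool (line_dist m \<mu> i (r s) = 0))"
    proof (rule sum.mono_neutral_right)
      have "line_dist m (fst l) (snd l) (r s) \<noteq> 0" if "l \<in> I - {(\<nu>, j)}" for l
        using s that unfolding case_prod_beta by blast
      then show "\<forall>l\<in>I - {(\<nu>, j)}. (case l of (\<mu>, i) \<Rightarrow> \<epsilon> \<mu> i * of_bool (line_dist m \<mu> i (r s) = 0)) = 0"
        by (simp add: case_prod_beta)
    qed (use \<nu> j in \<open>auto simp: I_def\<close>)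
    also have "\<dots> = \<epsilon> \<nu> j"
      unfolding r_def line_dist_ray by simp
    finally show "\<epsilon> \<nu> j = tents_limit m \<epsilon> (r s)"
      unfolding tents_limit_def using \<epsilon> by (simp add: clip_id)
  qed
  moreover have "integral ?S (\<lambda>s. \<epsilon> \<nu> j) = 2 * sin (theta m j) * \<epsilon> \<nu> j"
    using sin by simp
  ultimately show ?thesis by (simp only: radon_cos[OF sin] r_def)
qed

text \<open>Choosing the sign of each \<open>T_fun m j \<nu> p\<close> makes all terms of the limit
  add up. The bound need not be attained: it is a limit of values of admissible functions, each
  below the norm.\<close>

lemma lebesgue_fun_le_op_norm:
  assumes p: "p \<in> B2"
  shows "ereal (2 * lebesgue_fun m p) \<le> op_norm (A_op m)"
proof -
  define \<epsilon> where "\<epsilon> \<nu> j = sgn (T_fun m j \<nu> p)" for \<nu> j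
  have "(\<lambda>n. A_op m (tents m \<epsilon> n) p)
      \<longlonglongrightarrow> (\<Sum>\<nu> = 0..2 * m. \<Sum>j = 1..2 * m. 2 * sin (theta m j) * \<epsilon> \<nu> j * T_fun m j \<nu> p)"
    unfolding A_op_def
    by (intro tendsto_sum tendsto_mult tendsto_const radon_tents_limit) (auto simp: \<epsilon>_def sgn_if)
  also have "(\<Sum>\<nu> = 0..2 * m. \<Sum>j = 1..2 * m. 2 * sin (theta m j) * \<epsilon> \<nu> j * T_fun m j \<nu> p) = 2 * lebesgue_fun m p"
    unfolding lebesgue_fun_def sum_distrib_left \<epsilon>_def
    by (intro sum.cong refl) (simp add: abs_sgn mult_ac)
  finally have "(\<lambda>n. ereal (A_op m (tents m \<epsilon> n) p)) \<longlonglongrightarrow> ereal (2 * lebesgue_fun m p)"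
    by (rule tendsto_ereal)
  then show ?thesis
  proof (rule LIMSEQ_le_const2, intro exI allI impI)
    fix n
    have "ereal (A_op m (tents m \<epsilon> n) p) \<le> ereal \<bar>A_op m (tents m \<epsilon> n) p\<bar>" by simp
    also have "\<dots> \<le> op_norm (A_op m)"
    proof (rule abs_A_op_le_op_norm[OF _ _ p])
      show "tents m \<epsilon> n \<in> C_B2" unfolding C_B2_def by (simp add: continuous_on_tents)
      show "unif_norm (tents m \<epsilon> n) \<le> 1"
        unfolding one_ereal_def unif_norm_le_iff tents_def by (simp add: abs_clip_le)
    qed
    finally show "ereal (A_op m (tents m \<epsilon> n) p) \<le> op_norm (A_op m)" .
  qed
qed

theorem theorem5p2:
  "\<exists>c1 c2 :: real. c1 > 0 \<and> c2 > 0 \<and>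
     (\<forall>m :: nat.
        ereal (c1 * (real m * ln (real m + 1))) \<le> op_norm (A_op m) \<and>
        op_norm (A_op m) \<le> ereal (c2 * (real m * ln (real m + 1))))"
proof (intro exI conjI allI)
  \<comment> \<open>The lower constant comes from 2 * 2m / (24 pi) = m / (6 pi), the upper one is 48
    * 3 * 13.\<close>
  show "(1 / (6 * pi) :: real) > 0" "(1872 :: real) > 0" by simp_all
  fix m :: nat
  let ?L = "ln (real m + 1)"
  have origin: "(0, 0) \<in> B2" by (simp add: B2_def)
  have L: "0 \<le> ?L" by simp
  show "ereal (1 / (6 * pi) * (real m * ?L)) \<le> op_norm (A_op m)"
  proof -
    have "1 / (6 * pi) * (real m * ?L) \<le> 2 * lebesgue_fun m (0, 0)"
    proof (cases "m = 0")
      \<comment> \<open>For m = 0 the range of j is empty, so the Lebesgue function is 0, as is m ln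
        (m + 1).\<close>
      case True
      then show ?thesis by (simp add: lebesgue_fun_def)
    next
      case False
      have "1 / (6 * pi) * (real m * ?L) = 2 * (real (2 * m) / (24 * pi) * ?L)" by simp
      also have "\<dots> \<le> 2 * (real (2 * m + 1) / (24 * pi) * ?L)"
        using L by (intro mult_left_mono mult_right_mono divide_right_mono) auto
      also have "\<dots> \<le> 2 * lebesgue_fun m (0, 0)"
        using False by (intro mult_left_mono lebesgue_fun_origin_ge) auto
      finally show ?thesis .
    qed
    then have "ereal (1 / (6 * pi) * (real m * ?L)) \<le> ereal (2 * lebesgue_fun m (0, 0))" by simp
    also have "\<dots> \<le> op_norm (A_op m)" by (rule lebesgue_fun_le_op_norm[OF origin])
    finally show ?thesis .
  qed
  show "op_norm (A_op m) \<le> ereal (1872 * (real m * ?L))"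
  proof (rule op_norm_A_op_le)
    fix p assume p: "p \<in> B2"
    show "2 * lebesgue_fun m p \<le> 1872 * (real m * ?L)"
    proof (cases "m = 0")
      case True
      then show ?thesis by (simp add: lebesgue_fun_def)
    next
      case False
      let ?N = "2 * m + 1"
      \<comment> \<open>For m > 0, ln (m + 1) is at least ln 2, hence at least 1/2, which absorbs
        constants: 1 + ln 6 + L is at most 6 + L, hence at most 13 L, where L = ln (m + 1).\<close>
      have "ln (1 / 2) \<le> (1 / 2 :: real) - 1" by (rule ln_le_minus_one) simp
      then have "1 / 2 \<le> ln (2 :: real)" by (simp add: ln_div)
      also have "\<dots> \<le> ?L" using False by simp
      finally have half: "1 / 2 \<le> ?L" .
      have "ln (6 * (real m + 1)) = ln 6 + ?L" by (rule ln_mult_pos) auto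
      moreover have "ln (6 :: real) \<le> 5" using ln_le_minus_one[of 6] by simp
      moreover have "ln (real (2 * ?N)) \<le> ln (6 * (real m + 1))" by simp
      moreover have "harm (2 * ?N) \<le> 1 + ln (real (2 * ?N))" by (rule harm_le_ln) simp
      ultimately have "harm (2 * ?N) \<le> 13 * ?L" using half by linarith
      then have "48 * real ?N * harm (2 * ?N) \<le> 48 * (3 * real m) * (13 * ?L)"
        using False harm_nonneg by (intro mult_mono) auto
      moreover have "2 * lebesgue_fun m p \<le> 2 * (24 * real ?N * harm (2 * ?N))"
        by (intro mult_left_mono lebesgue_fun_le p) simp
      ultimately show ?thesis by linarith
    qed
  qed
qed

end
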